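(* Consider instances of \textsc{Wide Family Hitting} in which $|\mathcal{F}_i| \le d$ for every $i$. There is a randomized algorithm solving such instances in time $k^{\mathcal{O}(\log d)} N^{\mathcal{O}(1)}$.
   Context: For an integer $k$ and a universe $U$, a family $\mathcal{F}$ of subsets of $U$ is $k$-wide if $|A\cup B|>k$ for any two distinct $A,B\in\mathcal{F}$. In \textsc{Wide Family Hitting}, the input is an integer $k$, a universe $U$, and $m$ $k$-wide families $\mathcal{F}_1,\ldots,\mathcal{F}_m$ over $U$; the task is to decide whether there exist $S_1\in\mathcal{F}_1,\ldots,S_m\in\mathcal{F}_m$ with $|\bigcup_{i=1}^m S_i|\le k$. The input size is $N=\sum_{i=1}^m\sum_{A\in\mathcal{F}_i}|A|$. A randomized algorithm here means one that gives the correct answer with constant probability.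
   Formalization: The factor N^{O(1)} is stated as (N+m+1)^{O(1)}, since N does not count families that are empty or contain only the empty set, and these must still be read; when there are no such families, m ≤ N and the bound is the one claimed. *)

theory Defs
  imports "HOL-Probability.Probability_Mass_Function"
begin

section \<open>Wide Family Hitting\<close>

definition wide :: "int \<Rightarrow> 'a set set \<Rightarrow> bool" where
  "wide k F \<longleftrightarrow> (\<forall>A\<in>F. \<forall>B\<in>F. A \<noteq> B \<longrightarrow> int (card (A \<union> B)) > k)"

definition wfh_instance :: "int \<Rightarrow> 'a set \<Rightarrow> 'a set set list \<Rightarrow> bool" where
  "wfh_instance k U Fs \<longleftrightarrow> finite U \<and> (\<forall>F\<in>set Fs. F \<subseteq> Pow U \<and> wide k F)"

definition wfh_yes :: "int \<Rightarrow> 'a set set list \<Rightarrow> bool" where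
  "wfh_yes k Fs \<longleftrightarrow>
     (\<exists>S. (\<forall>i<length Fs. S i \<in> Fs ! i) \<and> int (card (\<Union>i<length Fs. S i)) \<le> k)"

text \<open>
  The size below does not see families equal to \<open>{}\<close> or \<open>{{}}\<close>, although these have to be read
  and an empty family changes the answer. Time bounds therefore use the size plus the number of
  families; without such families the latter is at most the size.
\<close>

definition wfh_size :: "'a set set list \<Rightarrow> nat" where
  "wfh_size Fs = (\<Sum>F\<leftarrow>Fs. \<Sum>A\<in>F. card A)"


section \<open>Randomized random-access machines\<close>

text \<open>
  Programs are structured RAM programs over finitely many integer arrays, with addition and
  subtraction as the only arithmetic. A scalar variable is an array used at index 0 only.
  \<open>Draw x i e\<close> stores a uniformly random integer from \<open>{0..<e}\<close> in cell \<open>i\<close> of array \<open>x\<close>.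

  Every step costs one unit. Since a fixed program has expressions of bounded size and
  multiplication is not primitive, the bit length of the numbers grows by at most a constant
  per step, so unit cost and logarithmic cost are polynomially related.
\<close>

type_synonym state = "string \<Rightarrow> int \<Rightarrow> int"

datatype aexp = Const int | Load string aexp | Plus aexp aexp | Minus aexp aexp

datatype bexp = Less aexp aexp | Neg bexp | Conj bexp bexp

datatype com =
    Skip
  | Assign string aexp aexp
  | Draw string aexp aexp
  | Seq com com
  | Cond bexp com com
  | While bexp com

primrec aval :: "aexp \<Rightarrow> state \<Rightarrow> int" where
  "aval (Const n) s = n"
| "aval (Load x i) s = s x (aval i s)"
| "aval (Plus e1 e2) s = aval e1 s + aval e2 s"
| "aval (Minus e1 e2) s = aval e1 s - aval e2 s"

primrec bval :: "bexp \<Rightarrow> state \<Rightarrow> bool" where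
  "bval (Less e1 e2) s \<longleftrightarrow> aval e1 s < aval e2 s"
| "bval (Neg b) s \<longleftrightarrow> \<not> bval b s"
| "bval (Conj b1 b2) s \<longleftrightarrow> bval b1 s \<and> bval b2 s"

definition store :: "state \<Rightarrow> string \<Rightarrow> int \<Rightarrow> int \<Rightarrow> state" where
  "store s x i v = s(x := (s x)(i := v))"

definition uniform_below :: "int \<Rightarrow> int pmf" where
  "uniform_below n = (if n > 0 then pmf_of_set {0..<n} else return_pmf 0)"

fun step :: "com \<times> state \<Rightarrow> (com \<times> state) pmf" where
  "step (Skip, s) = return_pmf (Skip, s)"
| "step (Assign x i e, s) = return_pmf (Skip, store s x (aval i s) (aval e s))"
| "step (Draw x i e, s) =
     map_pmf (\<lambda>v. (Skip, store s x (aval i s) v)) (uniform_below (aval e s))"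
| "step (Seq c1 c2, s) =
     (if c1 = Skip then return_pmf (c2, s)
      else map_pmf (\<lambda>(c, s'). (Seq c c2, s')) (step (c1, s)))"
| "step (Cond b c1 c2, s) = return_pmf (if bval b s then c1 else c2, s)"
| "step (While b c, s) = return_pmf (if bval b s then Seq c (While b c) else Skip, s)"

primrec run :: "nat \<Rightarrow> com \<times> state \<Rightarrow> (com \<times> state) pmf" where
  "run 0 cfg = return_pmf cfg"
| "run (Suc t) cfg = bind_pmf (step cfg) (run t)"

definition initial :: "int list \<Rightarrow> state" where
  "initial xs = (\<lambda>x i. if x = ''input'' \<and> 0 \<le> i \<and> i < int (length xs) then xs ! nat i else 0)"

text \<open>
  The time bound \<open>T\<close> holds for all outcomes of the random draws; the program answers ``yes'' by
  leaving 1 in cell 0 of the array \<open>output\<close>. The error is two-sided, so the constant success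
  probability has to exceed 1/2; 2/3 is the usual choice.
\<close>

definition decides_within :: "com \<Rightarrow> int list \<Rightarrow> bool \<Rightarrow> real \<Rightarrow> bool" where
  "decides_within p xs answer T \<longleftrightarrow>
     (\<exists>t. real t \<le> T \<and>
        (\<forall>cfg \<in> set_pmf (run t (p, initial xs)). fst cfg = Skip) \<and>
        measure_pmf.prob (run t (p, initial xs))
          {cfg. (snd cfg ''output'' 0 = 1) = answer} \<ge> 2/3)"


section \<open>Encoding of instances\<close>

text \<open>
  Elements of the universe are named by arbitrary integers. An instance is written down by
  listing its families in order, and listing each family, each set and the universe in an
  arbitrary order without repetition.
\<close>

definition lists_set :: "int list \<Rightarrow> int set \<Rightarrow> bool" where
  "lists_set xs A \<longleftrightarrow> distinct xs \<and> set xs = A"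

definition lists_family :: "int list list \<Rightarrow> int set set \<Rightarrow> bool" where
  "lists_family xss F \<longleftrightarrow>
     (\<forall>xs\<in>set xss. distinct xs) \<and> distinct (map set xss) \<and> set ` set xss = F"

definition block :: "int list \<Rightarrow> int list" where
  "block xs = int (length xs) # xs"

definition family_code :: "int list list \<Rightarrow> int list" where
  "family_code xss = int (length xss) # concat (map block xss)"

definition wfh_code :: "int list \<Rightarrow> int \<Rightarrow> int set \<Rightarrow> int set set list \<Rightarrow> bool" where
  "wfh_code inp k U Fs \<longleftrightarrow>
     (\<exists>us L. lists_set us U \<and> list_all2 lists_family L Fs \<and>
        inp = k # int (length L) # concat (map family_code L) @ block us)"

end

theory Submission
  imports Defs
begin

text \<open>
  Plain deterministic backtracking is fast enough. Suppose a partial choice has union \<open>X\<close>, and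
  let \<open>R = k + 1 - card X\<close>. For two sets \<open>A \<noteq> B\<close> of the next family that both fit,
  \<open>r A = k + 1 - card (X \<union> A)\<close> and \<open>r B\<close> are at most \<open>R\<close>, and wideness gives
  \<open>r A + r B \<le> R\<close>. Hence all but the largest of these numbers are at most \<open>R / 2\<close>, and if there
  are at most \<open>2 ^ e\<close> of them, their \<open>e\<close>-th powers sum to at most \<open>R ^ e\<close>. By induction every
  level of the search tree has at most \<open>(k + 1) ^ e\<close> nodes, where \<open>e\<close> is about \<open>log 2 d\<close>. The
  surplus factor \<open>2 ^ e\<close> in \<open>(k + 1) ^ e \<le> 2 ^ e * k ^ e\<close> is polynomial in the input size, because
  a family has at most \<open>N + 1\<close> members.
\<close>

section \<open>Counting the nodes of the search tree\<close>

text \<open>Of the \<open>2 ^ e\<close> monomials in the expansion of \<open>(x + y) ^ e\<close>,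
  one is \<open>y ^ e\<close> and the others are at least \<open>x ^ e\<close> because
  \<open>x \<le> y\<close>. The induction multiplies out one factor at a time.\<close>

lemma power_add_ge:
  fixes x y :: nat
  assumes "x \<le> y"
  shows "y ^ e + (2 ^ e - 1) * x ^ e \<le> (x + y) ^ e"
proof (induction e)
  case 0
  show ?case by simp
next
  case (Suc e)
  define c :: nat where "c = 2 ^ e - 1"
  have c: "2 ^ Suc e - 1 = 2 * c + 1"
    unfolding c_def power_Suc using one_le_power[of "2::nat" e] by linarith
  have "x ^ e \<le> y ^ e" using assms by (rule power_mono) simp
  then have "x * x ^ e \<le> x * y ^ e" by (rule mult_le_mono2)
  moreover have "c * x ^ e * x \<le> c * x ^ e * y" using assms by (rule mult_le_mono2)
  ultimately have "y ^ Suc e + (2 * c + 1) * x ^ Suc e \<le> (x + y) * (y ^ e + c * x ^ e)"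
    by (simp only: power_Suc distrib_left distrib_right mult_2 mult_1 ac_simps)
  also have "\<dots> \<le> (x + y) * (x + y) ^ e"
    using Suc.IH by (simp add: c_def)
  finally show ?case by (simp only: c power_Suc[of "x + y"])
qed

text \<open>Let \<open>r i\<close> be the largest value and \<open>x\<close> the second largest. The
  other indices number at most \<open>2 ^ e - 1\<close> and contribute at most \<open>x ^ e\<close>
  each, while \<open>x + r i \<le> R\<close>, so \<open>power_add_ge\<close> applies.\<close>

lemma sum_power_le:
  fixes r :: "'i \<Rightarrow> nat"
  assumes "finite I" "card I \<le> 2 ^ e"
    and le: "\<And>i. i \<in> I \<Longrightarrow> r i \<le> R"
    and pair: "\<And>i j. i \<in> I \<Longrightarrow> j \<in> I \<Longrightarrow> i \<noteq> j \<Longrightarrow> r i + r j \<le> R"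
  shows "(\<Sum>i\<in>I. r i ^ e) \<le> R ^ e"
proof (cases "I = {}")
  case False
  then obtain i where i: "i \<in> I" "\<And>j. j \<in> I \<Longrightarrow> r j \<le> r i"
    using Max_in[of "r ` I"] Max_ge[of "r ` I"] \<open>finite I\<close> by fastforce
  \<comment> \<open>With a single index there is no second value; the default 0 turns
    \<open>x + r i \<le> R\<close> into the bound \<open>le\<close> on one index.\<close>
  define x where "x = (if I - {i} = {} then 0 else Max (r ` (I - {i})))"
  have x: "x \<le> r i \<and> x + r i \<le> R"
  proof (cases "I - {i} = {}")
    case True
    then show ?thesis using le i by (simp add: x_def)
  next
    case False
    then have "x \<in> r ` (I - {i})"
      using \<open>finite I\<close> Max_in[of "r ` (I - {i})"] by (simp add: x_def)
    then show ?thesis using i pair by auto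
  qed
  have "r j \<le> x" if "j \<in> I - {i}" for j
    using that \<open>finite I\<close> by (auto simp: x_def)
  then have "(\<Sum>j\<in>I - {i}. r j ^ e) \<le> card (I - {i}) * x ^ e"
    using sum_bounded_above[of "I - {i}" "\<lambda>j. r j ^ e" "x ^ e"] by (simp add: power_mono)
  also have "\<dots> \<le> (2 ^ e - 1) * x ^ e"
    using assms(1,2) i by (intro mult_right_mono) auto
  finally have "(\<Sum>j\<in>I. r j ^ e) \<le> r i ^ e + (2 ^ e - 1) * x ^ e"
    using \<open>finite I\<close> i by (simp add: sum.remove)
  also have "\<dots> \<le> (x + r i) ^ e" using x by (intro power_add_ge) simp
  also have "\<dots> \<le> R ^ e" using x by (intro power_mono) auto
  finally show ?thesis .
qed simp

text \<open>This is tailored to the loop of \<open>search\<close>: one round for every set tried,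
  one for leaving an exhausted family, one at a leaf. A success does not cut the count short, so it
  bounds the rounds from above.\<close>

fun visits :: "nat \<Rightarrow> 'a set \<Rightarrow> 'a list list list \<Rightarrow> nat" where
  "visits k X [] = 1"
| "visits k X (F # Fs) =
     1 + (\<Sum>A\<leftarrow>F. 1 + (if card (X \<union> set A) \<le> k then visits k (X \<union> set A) Fs else 0))"

definition listed_wide :: "nat \<Rightarrow> 'a list list \<Rightarrow> bool" where
  "listed_wide k F \<longleftrightarrow> distinct (map set F) \<and> wide (int k) (set ` set F)"

text \<open>Cardinalities are modular: the sizes of \<open>X \<union> set A\<close> and
  \<open>X \<union> set B\<close> add up to the size of their union, which is at least
  \<open>k + 1\<close> by wideness, plus that of their intersection, which is at least
  \<open>card X\<close>. Hence two remaining budgets sum to at most the budget of \<open>X\<close>,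
  as \<open>sum_power_le\<close> requires.\<close>

lemma sum_remaining_budget_le:
  assumes "listed_wide k F" "length F \<le> 2 ^ e" "finite X" "card X \<le> k"
  shows "(\<Sum>A\<leftarrow>F. if card (X \<union> set A) \<le> k then (k + 1 - card (X \<union> set A)) ^ e else 0)
    \<le> (k + 1 - card X) ^ e"
proof -
  define I where "I = {A \<in> set F. card (X \<union> set A) \<le> k}"
  define r where "r A = k + 1 - card (X \<union> set A)" for A
  have d: "distinct F" and inj: "inj_on set (set F)"
    using assms(1) by (auto simp: listed_wide_def distinct_map)
  have "(\<Sum>A\<leftarrow>F. if card (X \<union> set A) \<le> k then r A ^ e else 0) = (\<Sum>A\<in>I. r A ^ e)"
    using d by (simp add: sum_list_distinct_conv_sum_set I_def sum.inter_filter)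
  also have "\<dots> \<le> (k + 1 - card X) ^ e"
  proof (rule sum_power_le)
    show "finite I" by (simp add: I_def)
    have "card I \<le> card (set F)" by (intro card_mono) (auto simp: I_def)
    then show "card I \<le> 2 ^ e" using assms(2) card_length[of F] by linarith
    show "r A \<le> k + 1 - card X" if "A \<in> I" for A
      using card_mono[of "X \<union> set A" X] \<open>finite X\<close> by (simp add: r_def)
    show "r A + r B \<le> k + 1 - card X" if AB: "A \<in> I" "B \<in> I" "A \<noteq> B" for A B
    proof -
      have "set A \<noteq> set B" using AB inj by (auto simp: I_def inj_on_def)
      then have "card (set A \<union> set B) > k"
        using AB assms(1) by (auto simp: listed_wide_def wide_def I_def)
      moreover have "card (set A \<union> set B) \<le> card ((X \<union> set A) \<union> (X \<union> set B))"
        using \<open>finite X\<close> by (intro card_mono) auto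
      moreover have "card ((X \<union> set A) \<union> (X \<union> set B)) + card ((X \<union> set A) \<inter> (X \<union> set B))
          = card (X \<union> set A) + card (X \<union> set B)"
        using card_Un_Int[of "X \<union> set A" "X \<union> set B"] \<open>finite X\<close> by simp
      moreover have "card X \<le> card ((X \<union> set A) \<inter> (X \<union> set B))"
        using \<open>finite X\<close> by (intro card_mono) auto
      ultimately show ?thesis using AB by (simp add: r_def I_def)
    qed
  qed
  finally show ?thesis unfolding r_def .
qed

text \<open>The power of the remaining budget is a potential that does not grow from one level of
  the tree to the next. Each of the \<open>length Fs + 1\<close> levels is charged
  \<open>D + 1\<close> times this potential.\<close>

lemma visits_le:
  assumes "\<And>F. F \<in> set Fs \<Longrightarrow> listed_wide k F \<and> length F \<le> D" "D \<le> 2 ^ e"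
    and "finite X" "card X \<le> k"
  shows "visits k X Fs \<le> (D + 1) * (length Fs + 1) * (k + 1 - card X) ^ e"
  using assms(1,3,4)
proof (induction Fs arbitrary: X)
  case Nil
  then have "1 \<le> (k + 1 - card X) ^ e" by simp
  then show ?case by (simp add: trans_le_add1)
next
  case (Cons F Fs)
  let ?c = "(D + 1) * (length Fs + 1)"
  let ?g = "\<lambda>A. if card (X \<union> set A) \<le> k then (k + 1 - card (X \<union> set A)) ^ e else 0"
  have F: "listed_wide k F" "length F \<le> D" using Cons.prems by auto
  have eq: "(1 + D) * w + ?c * w = (D + 1) * (length (F # Fs) + 1) * w" for w
    by (simp add: algebra_simps)
  have "(if card (X \<union> set A) \<le> k then visits k (X \<union> set A) Fs else 0) \<le> ?c * ?g A" for A
    using Cons.IH[of "X \<union> set A"] Cons.prems by simp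
  then have "visits k X (F # Fs) \<le> 1 + (\<Sum>A\<leftarrow>F. 1 + ?c * ?g A)"
    unfolding visits.simps by (intro add_left_mono sum_list_mono)
  also have "\<dots> = 1 + length F + ?c * (\<Sum>A\<leftarrow>F. ?g A)"
    by (simp only: sum_list_addf sum_list_const_mult sum_list_triv) simp
  also have "\<dots> \<le> (1 + D) * (k + 1 - card X) ^ e + ?c * (k + 1 - card X) ^ e"
  proof (intro add_mono mult_left_mono)
    \<comment> \<open>As \<open>card X \<le> k\<close>, the budget \<open>k + 1 - card X\<close> is
      at least 1, and so is its power; this is why the budget starts at
      \<open>k + 1\<close>.\<close>
    show "1 + length F \<le> (1 + D) * (k + 1 - card X) ^ e"
      using F Cons.prems mult_le_mono[of "1 + length F" "1 + D" 1 "(k + 1 - card X) ^ e"] by simp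
    show "(\<Sum>A\<leftarrow>F. ?g A) \<le> (k + 1 - card X) ^ e"
      using F Cons.prems(2,3) assms(2) by (intro sum_remaining_budget_le) auto
  qed simp
  also have "\<dots> = (D + 1) * (length (F # Fs) + 1) * (k + 1 - card X) ^ e" by (rule eq)
  finally show ?case .
qed

section \<open>Backtracking with pruning decides the problem\<close>

fun extendable :: "nat \<Rightarrow> 'a set \<Rightarrow> 'a list list list \<Rightarrow> bool" where
  "extendable k X [] \<longleftrightarrow> True"
| "extendable k X (F # Fs) \<longleftrightarrow>
     (\<exists>A\<in>set F. card (X \<union> set A) \<le> k \<and> extendable k (X \<union> set A) Fs)"

text \<open>Checking the bound after every choice loses no solution, because each partial union is
  contained in the final one.\<close>

lemma extendable_iff:
  assumes "finite X" "card X \<le> k"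
  shows "extendable k X Fs \<longleftrightarrow>
    (\<exists>S. (\<forall>i<length Fs. S i \<in> set ` set (Fs ! i)) \<and> card (X \<union> (\<Union>i<length Fs. S i)) \<le> k)"
  using assms
proof (induction Fs arbitrary: X)
  case (Cons F Fs)
  have shift: "(\<Union>i<Suc n. S i) = S 0 \<union> (\<Union>i<n. S (Suc i))" for n and S :: "nat \<Rightarrow> 'a set"
    by (simp only: lessThan_Suc_eq_insert_0) auto
  show ?case
  proof
    assume "extendable k X (F # Fs)"
    then obtain A where A: "A \<in> set F" "card (X \<union> set A) \<le> k" "extendable k (X \<union> set A) Fs"
      by auto
    then obtain S where S: "\<forall>i<length Fs. S i \<in> set ` set (Fs ! i)"
      "card (X \<union> set A \<union> (\<Union>i<length Fs. S i)) \<le> k"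
      using Cons.IH[of "X \<union> set A"] Cons.prems by auto
    show "\<exists>S. (\<forall>i<length (F # Fs). S i \<in> set ` set ((F # Fs) ! i)) \<and>
        card (X \<union> (\<Union>i<length (F # Fs). S i)) \<le> k"
    proof (intro exI[of _ "case_nat (set A) S"] conjI allI impI)
      fix i assume "i < length (F # Fs)"
      then show "case_nat (set A) S i \<in> set ` set ((F # Fs) ! i)"
        using A(1) S(1) by (cases i) auto
    next
      show "card (X \<union> (\<Union>i<length (F # Fs). case_nat (set A) S i)) \<le> k"
        using S(2) by (simp add: shift Un_assoc del: UN_simps)
    qed
  next
    assume "\<exists>S. (\<forall>i<length (F # Fs). S i \<in> set ` set ((F # Fs) ! i)) \<and>
        card (X \<union> (\<Union>i<length (F # Fs). S i)) \<le> k"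
    then obtain S where S: "\<And>i. i < Suc (length Fs) \<Longrightarrow> S i \<in> set ` set ((F # Fs) ! i)"
      "card (X \<union> (\<Union>i<Suc (length Fs). S i)) \<le> k"
      by auto
    from S(1)[of 0] obtain A where A: "A \<in> set F" "S 0 = set A" by auto
    have S': "S (Suc i) \<in> set ` set (Fs ! i)" if "i < length Fs" for i
      using S(1)[of "Suc i"] that by simp
    \<comment> \<open>Monotonicity of \<open>card\<close> needs a finite larger set; each chosen set
      is finite since it comes from a list.\<close>
    then have "finite (S (Suc i))" if "i < length Fs" for i
      using that by fastforce
    then have fin: "finite (\<Union>i<length Fs. S (Suc i))" by simp
    have c: "card (X \<union> set A \<union> (\<Union>i<length Fs. S (Suc i))) \<le> k"
      using S(2) by (simp add: shift A(2) Un_assoc del: UN_simps)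
    moreover have "card (X \<union> set A) \<le> card (X \<union> set A \<union> (\<Union>i<length Fs. S (Suc i)))"
      using fin Cons.prems by (intro card_mono) auto
    ultimately have le: "card (X \<union> set A) \<le> k" by simp
    then have "extendable k (X \<union> set A) Fs"
      using Cons.IH[of "X \<union> set A"] Cons.prems S' c
      by (auto intro!: exI[of _ "\<lambda>i. S (Suc i)"])
    then show "extendable k X (F # Fs)" using A le by auto
  qed
qed simp

section \<open>Deterministic execution\<close>

text \<open>Every step must be a point distribution, so this describes deterministic runs. Since
  \<open>refl\<close> accepts any number, \<open>n\<close> is only an upper bound on the number of
  steps and may be rounded up.\<close>

inductive reach :: "nat \<Rightarrow> com \<times> state \<Rightarrow> com \<times> state \<Rightarrow> bool" where
  refl: "reach n x x"
| step: "step x = return_pmf y \<Longrightarrow> reach n y z \<Longrightarrow> reach (Suc n) x z"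

lemma reach_trans: "reach m x y \<Longrightarrow> reach n y z \<Longrightarrow> reach (m + n) x z"
proof (induction rule: reach.induct)
  case (refl m x)
  \<comment> \<open>The \<open>m\<close> units left over by \<open>refl\<close> are handed to the
    second run; the inner induction raises its bound from \<open>n\<close> to
    \<open>m + n\<close>.\<close>
  show ?case using refl
  proof (induction arbitrary: m rule: reach.induct)
    case (refl n x)
    show ?case by (rule reach.refl)
  next
    case (step x y n z)
    then show ?case using reach.step[OF step(1) step(3)[of m]] by simp
  qed
qed (auto intro: reach.step)

lemma reach_mono: "reach m x y \<Longrightarrow> m \<le> n \<Longrightarrow> reach n x y"
  using reach_trans[of m x y "n - m" y] by (simp add: reach.refl)

lemma reach_one: "step x = return_pmf y \<Longrightarrow> reach 1 x y"
  using reach.step[OF _ reach.refl[of 0]] by simp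

lemma reach_run: "reach n x y \<Longrightarrow> \<exists>t\<le>n. run t x = return_pmf y"
proof (induction rule: reach.induct)
  case (refl n x)
  show ?case by (intro exI[of _ 0]) simp
next
  case (step x y n z)
  then obtain t where "t \<le> n" "run t y = return_pmf z" by blast
  with step(1) show ?case by (intro exI[of _ "Suc t"]) (simp add: bind_return_pmf)
qed

lemma reach_Seq1:
  assumes "reach n (c, s) (c', s')"
  shows "reach n (Seq c d, s) (Seq c' d, s')"
proof -
  have "reach n (Seq (fst x) d, snd x) (Seq (fst y) d, snd y)" if "reach n x y" for x y
    using that
  proof (induction rule: reach.induct)
    case (step x y n z)
    show ?case
    proof (cases "fst x = Skip")
      \<comment> \<open>A finished configuration steps to itself, whereas \<open>Seq Skip d\<close>
        would move on to \<open>d\<close>. Such idle steps are therefore dropped, which only lowers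
        the true count.\<close>
      case True
      then have "x = y" using step(1) by (cases x) simp
      then show ?thesis using step(3) by (auto intro: reach_mono)
    next
      case False
      then have "step (Seq (fst x) d, snd x) = return_pmf (Seq (fst y) d, snd y)"
        using step(1) by (simp add: case_prod_unfold)
      then show ?thesis using step(3) by (rule reach.step)
    qed
  qed (rule reach.refl)
  from this[OF assms] show ?thesis by simp
qed

lemma reach_Seq:
  assumes "reach m (c, s) (Skip, s')" "reach n (d, s') x" "m + 1 + n \<le> t"
  shows "reach t (Seq c d, s) x"
proof -
  have "reach 1 (Seq Skip d, s') (d, s')" by (rule reach_one) simp
  from reach_trans[OF reach_trans[OF reach_Seq1[OF assms(1)] this] assms(2)]
  show ?thesis using assms(3) by (rule reach_mono)
qed

lemma reach_Cond:
  assumes "reach n (if bval b s then c else d, s) x" "n + 1 \<le> t"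
  shows "reach t (Cond b c d, s) x"
  using reach_mono[OF reach.step[OF step.simps(5) assms(1)]] assms(2) by simp

text \<open>The two extra steps unfold the loop and discard the \<open>Skip\<close> left by the
  body.\<close>

lemma reach_While:
  assumes "bval b s" "reach n (c, s) (Skip, s')"
  shows "reach (n + 2) (While b c, s) (While b c, s')"
proof -
  have "reach 1 (While b c, s) (Seq c (While b c), s)"
    by (rule reach_one) (simp add: assms(1))
  from reach_trans[OF this reach_Seq[OF assms(2) reach.refl[of 0] order.refl]]
  show ?thesis by simp
qed

lemma reach_While_exit: "\<not> bval b s \<Longrightarrow> reach 1 (While b c, s) (Skip, s)"
  by (rule reach_one) simp

text \<open>The invariant is indexed by the number of completed rounds, so the number of rounds is
  known to be exactly \<open>n\<close>; the final 1 pays for the failing test.\<close>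

lemma reach_counted_loop:
  assumes body: "\<And>i s. i < n \<Longrightarrow> P i s \<Longrightarrow> bval b s \<and> (\<exists>s'. reach t (c, s) (Skip, s') \<and> P (Suc i) s')"
    and exit: "\<And>s. P n s \<Longrightarrow> \<not> bval b s" and init: "P 0 s"
  shows "\<exists>s'. reach (n * (t + 2) + 1) (While b c, s) (Skip, s') \<and> P n s'"
proof -
  have "\<exists>s'. reach (i * (t + 2)) (While b c, s) (While b c, s') \<and> P i s'" if "i \<le> n" for i
    using that
  proof (induction i)
    case 0
    then show ?case using init reach.refl by blast
  next
    case (Suc i)
    then obtain s' where s': "reach (i * (t + 2)) (While b c, s) (While b c, s')" "P i s'" by auto
    obtain s'' where "bval b s'" "reach t (c, s') (Skip, s'')" "P (Suc i) s''"
      using body[of i s'] s'(2) Suc.prems by auto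
    then show ?case
      using reach_trans[OF s'(1) reach_While[of b s' t c s'']]
      by (intro exI[of _ s'']) (simp add: algebra_simps)
  qed
  from this[of n] obtain s' where "reach (n * (t + 2)) (While b c, s) (While b c, s')" "P n s'"
    by auto
  then show ?thesis using reach_trans reach_While_exit[OF exit] by blast
qed

section \<open>Loop-free commands\<close>

fun while_free :: "com \<Rightarrow> bool" where
  "while_free (Seq c d) \<longleftrightarrow> while_free c \<and> while_free d"
| "while_free (Cond b c d) \<longleftrightarrow> while_free c \<and> while_free d"
| "while_free (While b c) \<longleftrightarrow> False"
| "while_free (Draw x i e) \<longleftrightarrow> False"
| "while_free c \<longleftrightarrow> True"

text \<open>For \<open>while_free\<close> commands the final state can be computed by rewriting. The
  values at loops and draws are placeholders.\<close>

fun effect :: "com \<Rightarrow> state \<Rightarrow> state" where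
  "effect (Assign x i e) s = store s x (aval i s) (aval e s)"
| "effect (Seq c d) s = effect d (effect c s)"
| "effect (Cond b c d) s = (if bval b s then effect c s else effect d s)"
| "effect c s = s"

text \<open>Charging both branches of a conditional makes the bound independent of the
  state.\<close>

fun duration :: "com \<Rightarrow> nat" where
  "duration (Assign x i e) = 1"
| "duration (Seq c d) = duration c + 1 + duration d"
| "duration (Cond b c d) = duration c + duration d + 1"
| "duration c = 0"

lemma reach_duration: "while_free c \<Longrightarrow> reach (duration c) (c, s) (Skip, effect c s)"
proof (induction c arbitrary: s)
  case (Assign x i e)
  show ?case using reach_one[OF step.simps(2)] by simp
next
  case (Seq c d)
  then show ?case by (auto intro!: reach_Seq[of "duration c" c s _ "duration d"])
next
  case (Cond b c d)
  then have "reach (duration c + duration d) (if bval b s then c else d, s)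
      (Skip, if bval b s then effect c s else effect d s)"
    by (auto intro: reach_mono[where m = "duration c"] reach_mono[where m = "duration d"])
  then show ?case by (auto intro: reach_Cond)
qed (auto intro: reach.refl)

lemma reach_effect:
  "while_free c \<Longrightarrow> duration c \<le> n \<Longrightarrow> reach n (c, s) (Skip, effect c s)"
  by (rule reach_mono[OF reach_duration])

lemma store_apply [simp]: "store s x i v y j = (if y = x \<and> j = i then v else s y j)"
  by (simp add: store_def)

section \<open>The search program\<close>

abbreviation Var :: "string \<Rightarrow> aexp" where
  "Var x \<equiv> Load x (Const 0)"

abbreviation Set :: "string \<Rightarrow> aexp \<Rightarrow> com" where
  "Set x e \<equiv> Assign x (Const 0) e"

abbreviation Incr :: "string \<Rightarrow> com" where
  "Incr x \<equiv> Set x (Plus (Var x) (Const 1))"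

abbreviation Decr :: "string \<Rightarrow> com" where
  "Decr x \<equiv> Set x (Minus (Var x) (Const 1))"

section \<open>Input layout and marked sets\<close>

definition holds :: "(int \<Rightarrow> int) \<Rightarrow> int \<Rightarrow> int list \<Rightarrow> bool" where
  "holds f p xs \<longleftrightarrow> (\<forall>j<length xs. f (p + int j) = xs ! j)"

lemma holds_Nil [simp]: "holds f p []"
  by (simp add: holds_def)

lemma holds_Cons [simp]: "holds f p (x # xs) \<longleftrightarrow> f p = x \<and> holds f (p + 1) xs"
  by (auto simp: holds_def less_Suc_eq_0_disj algebra_simps)

lemma holds_append [simp]:
  "holds f p (xs @ ys) \<longleftrightarrow> holds f p xs \<and> holds f (p + int (length xs)) ys"
  by (induction xs arbitrary: p) (auto simp: add.assoc add.commute)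

lemma length_block [simp]: "length (block A) = length A + 1"
  by (simp add: block_def)

text \<open>
  In each round the elements of the union are marked with the number of the round, so that the
  marks need not be cleared.
\<close>

definition unmarked :: "state \<Rightarrow> bool" where
  "unmarked s \<longleftrightarrow> (\<forall>e. s ''mark'' e \<le> s ''round'' 0)"

definition marked :: "state \<Rightarrow> int set \<Rightarrow> bool" where
  "marked s X \<longleftrightarrow> unmarked s \<and> finite X \<and> (\<forall>e. s ''mark'' e = s ''round'' 0 \<longleftrightarrow> e \<in> X) \<and>
     s ''union'' 0 = int (card X)"

definition mark_element :: com where
  "mark_element =
     Seq (Cond (Less (Load ''mark'' (Load ''input'' (Var ''position''))) (Var ''round''))
            (Seq (Assign ''mark'' (Load ''input'' (Var ''position'')) (Var ''round''))
                 (Incr ''union''))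
            Skip)
     (Seq (Incr ''position'') (Decr ''quota''))"

definition mark_block :: com where
  "mark_block =
     Seq (Seq (Set ''position'' (Load ''selected'' (Var ''family'')))
         (Seq (Set ''quota'' (Load ''input'' (Var ''position'')))
              (Incr ''position'')))
     (Seq (While (Less (Const 0) (Var ''quota'')) mark_element)
          (Incr ''family''))"

text \<open>The union is recomputed from all selected sets, levels 0 to \<open>level\<close>
  inclusive, instead of being updated. Backtracking then has nothing to undo, at the price of a
  polynomial factor.\<close>

definition measure_union :: com where
  "measure_union =
     Seq (Seq (Incr ''round'') (Seq (Set ''union'' (Const 0)) (Set ''family'' (Const 0))))
         (While (Neg (Less (Var ''level'') (Var ''family''))) mark_block)"

definition skip_block :: com where
  "skip_block =
     Seq (Set ''position''
           (Plus (Var ''position'') (Plus (Load ''input'' (Var ''position'')) (Const 1))))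
         (Decr ''quota'')"

definition descend :: com where
  "descend =
     Seq (Seq (Set ''position'' (Load ''cursor'' (Var ''level'')))
              (Set ''quota'' (Load ''todo'' (Var ''level''))))
     (Seq (While (Less (Const 0) (Var ''quota'')) skip_block)
     (Seq (Incr ''level'')
     (Seq (Assign ''cursor'' (Var ''level'') (Plus (Var ''position'') (Const 1)))
          (Assign ''todo'' (Var ''level'') (Load ''input'' (Var ''position''))))))"

definition select :: com where
  "select =
     Seq (Assign ''selected'' (Var ''level'') (Load ''cursor'' (Var ''level'')))
     (Seq (Assign ''cursor'' (Var ''level'')
            (Plus (Load ''cursor'' (Var ''level''))
                  (Plus (Load ''input'' (Load ''cursor'' (Var ''level''))) (Const 1))))
          (Assign ''todo'' (Var ''level'') (Minus (Load ''todo'' (Var ''level'')) (Const 1))))"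

definition try_next :: com where
  "try_next =
     Seq select
     (Seq measure_union
          (Cond (Less (Var ''input'') (Var ''union'')) Skip descend))"

definition search_step :: com where
  "search_step =
     Cond (Less (Var ''level'') (Load ''input'' (Const 1)))
       (Cond (Less (Const 0) (Load ''todo'' (Var ''level''))) try_next (Decr ''level''))
       (Set ''output'' (Const 1))"

text \<open>Level -1 means that the root has been exhausted without success.\<close>

definition search :: com where
  "search =
     While (Conj (Neg (Less (Var ''level'') (Const 0))) (Less (Var ''output'') (Const 1)))
       search_step"

definition solver :: com where
  "solver =
     Cond (Less (Var ''input'') (Const 0)) Skip
       (Seq (Seq (Set ''cursor'' (Const 3)) (Set ''todo'' (Load ''input'' (Const 2)))) search)"

section \<open>Correctness and cost of the subroutines\<close>

definition agree :: "string set \<Rightarrow> state \<Rightarrow> state \<Rightarrow> bool" where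
  "agree V s s' \<longleftrightarrow> (\<forall>x. x \<notin> V \<longrightarrow> s' x = s x)"

lemma mark_element_correct:
  assumes "marked s X" "s ''input'' (s ''position'' 0) = e"
  defines "s' \<equiv> effect mark_element s"
  shows "reach 9 (mark_element, s) (Skip, s')" "marked s' (insert e X)"
    "s' ''position'' 0 = s ''position'' 0 + 1" "s' ''quota'' 0 = s ''quota'' 0 - 1"
    "agree {''mark'', ''union'', ''position'', ''quota''} s s'"
proof -
  show "reach 9 (mark_element, s) (Skip, s')"
    unfolding s'_def by (rule reach_effect) (simp_all add: mark_element_def)
  have "s ''mark'' e \<le> s ''round'' 0" and eq: "s ''mark'' e = s ''round'' 0 \<longleftrightarrow> e \<in> X"
    using assms(1) unfolding marked_def unmarked_def by blast+
  \<comment> \<open>No mark exceeds the current round, so a smaller mark means exactly that the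
    element is new; thus each element is counted once.\<close>
  then have "s ''mark'' e < s ''round'' 0 \<longleftrightarrow> e \<notin> X" by linarith
  then have "s' ''mark'' = (s ''mark'')(e := s ''round'' 0)"
    "s' ''union'' 0 = (if e \<in> X then s ''union'' 0 else s ''union'' 0 + 1)"
    "s' ''round'' = s ''round''"
    by (simp_all add: s'_def mark_element_def assms(2) eq fun_eq_iff)
  then show "marked s' (insert e X)"
    using assms(1) by (simp add: marked_def unmarked_def insert_absorb)
  show "s' ''position'' 0 = s ''position'' 0 + 1" "s' ''quota'' 0 = s ''quota'' 0 - 1"
    "agree {''mark'', ''union'', ''position'', ''quota''} s s'"
    by (auto simp: s'_def mark_element_def agree_def fun_eq_iff)
qed

lemma mark_block_correct:
  assumes "marked s X" and A: "holds (s ''input'') (s ''selected'' (s ''family'' 0)) (block A)"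
    and n: "length A \<le> n"
  shows "\<exists>s'. reach (11 * n + 9) (mark_block, s) (Skip, s') \<and> marked s' (X \<union> set A) \<and>
    s' ''family'' 0 = s ''family'' 0 + 1 \<and>
    agree {''mark'', ''union'', ''position'', ''quota'', ''family''} s s'"
proof -
  let ?V = "{''mark'', ''union'', ''position'', ''quota''}"
  define c where "c = Seq (Set ''position'' (Load ''selected'' (Var ''family'')))
    (Seq (Set ''quota'' (Load ''input'' (Var ''position''))) (Incr ''position''))"
  define s1 where "s1 = effect c s"
  have c: "reach 5 (c, s) (Skip, s1)"
    unfolding s1_def by (rule reach_effect) (simp_all add: c_def)
  define q where "q = s ''selected'' (s ''family'' 0) + 1"
  have A': "s ''input'' (q + int i) = A ! i" if "i < length A" for i
    using A that by (auto simp: block_def q_def holds_def[of _ _ A])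
  have s1: "marked s1 X" "s1 ''position'' 0 = q" "s1 ''quota'' 0 = int (length A)" "agree ?V s s1"
    using assms by (auto simp: s1_def c_def q_def marked_def unmarked_def agree_def fun_eq_iff block_def)
  define P where "P i t \<longleftrightarrow> marked t (X \<union> set (take i A)) \<and> t ''position'' 0 = q + int i \<and>
    t ''quota'' 0 = int (length A) - int i \<and> agree ?V s t" for i :: nat and t
  have "\<exists>s'. reach (length A * (9 + 2) + 1)
      (While (Less (Const 0) (Var ''quota'')) mark_element, s1) (Skip, s') \<and> P (length A) s'"
  proof (rule reach_counted_loop)
    fix i t assume i: "i < length A" and P: "P i t"
    have "t ''input'' (t ''position'' 0) = A ! i"
      using A'[OF i] P by (simp add: P_def agree_def)
    then have "P (Suc i) (effect mark_element t)"
      using mark_element_correct[of t "X \<union> set (take i A)" "A ! i"] P i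
      by (auto simp: P_def take_Suc_conv_app_nth agree_def)
    then show "bval (Less (Const 0) (Var ''quota'')) t \<and>
        (\<exists>t'. reach 9 (mark_element, t) (Skip, t') \<and> P (Suc i) t')"
      using mark_element_correct(1)[of t "X \<union> set (take i A)" "A ! i"]
        \<open>t ''input'' (t ''position'' 0) = A ! i\<close> P i by (auto simp: P_def)
  qed (use s1 in \<open>auto simp: P_def\<close>)
  then obtain s2 where s2: "reach (length A * 11 + 1)
      (While (Less (Const 0) (Var ''quota'')) mark_element, s1) (Skip, s2)" "P (length A) s2"
    by auto
  define s3 where "s3 = effect (Incr ''family'') s2"
  have "reach 1 (Incr ''family'', s2) (Skip, s3)"
    unfolding s3_def by (rule reach_effect) simp_all
  then have "reach (11 * n + 9) (mark_block, s) (Skip, s3)"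
    unfolding mark_block_def c_def[symmetric] using n
    by (intro reach_Seq[OF c] reach_Seq[OF s2(1)] order.refl) auto
  then show ?thesis
    using s2(2) by (intro exI[of _ s3])
      (auto simp: s3_def P_def marked_def unmarked_def agree_def fun_eq_iff)
qed

text \<open>Here \<open>As\<close> already includes the set just selected at the current level,
  hence the offset of 1 between its length and \<open>level\<close>.\<close>

lemma measure_union_correct:
  assumes "unmarked s" and level: "s ''level'' 0 = int (length As) - 1"
    and As: "\<And>j. j < length As \<Longrightarrow> holds (s ''input'') (s ''selected'' (int j)) (block (As ! j))"
    and n: "\<And>A. A \<in> set As \<Longrightarrow> length A \<le> n" "length As \<le> n"
  shows "\<exists>s'. reach (n * (11 * n + 11) + 7) (measure_union, s) (Skip, s') \<and>
    marked s' (\<Union>(set ` set As)) \<and>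
    agree {''mark'', ''union'', ''position'', ''quota'', ''family'', ''round''} s s'"
proof -
  let ?V = "{''mark'', ''union'', ''position'', ''quota'', ''family'', ''round''}"
  define c where "c = Seq (Incr ''round'') (Seq (Set ''union'' (Const 0)) (Set ''family'' (Const 0)))"
  define s1 where "s1 = effect c s"
  have c: "reach 5 (c, s) (Skip, s1)"
    unfolding s1_def by (rule reach_effect) (simp_all add: c_def)
  define P where "P i t \<longleftrightarrow> marked t (\<Union>(set ` set (take i As))) \<and> t ''family'' 0 = int i \<and>
    agree ?V s t" for i :: nat and t
  \<comment> \<open>After \<open>round\<close> is incremented every old mark is strictly smaller, so
    the marked set is empty again.\<close>
  have "s ''mark'' e < s ''round'' 0 + 1" for e
    using assms(1) by (simp add: unmarked_def)
  then have P0: "P 0 s1"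
    by (auto simp: P_def s1_def c_def marked_def unmarked_def agree_def fun_eq_iff
        order.strict_implies_order order.strict_implies_not_eq)
  have "\<exists>s'. reach (length As * ((11 * n + 9) + 2) + 1)
      (While (Neg (Less (Var ''level'') (Var ''family''))) mark_block, s1) (Skip, s') \<and>
      P (length As) s'"
  proof (rule reach_counted_loop)
    fix i t assume i: "i < length As" and P: "P i t"
    have "holds (t ''input'') (t ''selected'' (t ''family'' 0)) (block (As ! i))"
      using As[OF i] P by (simp add: P_def agree_def)
    then obtain t' where t': "reach (11 * n + 9) (mark_block, t) (Skip, t')"
      "marked t' (\<Union>(set ` set (take i As)) \<union> set (As ! i))"
      "t' ''family'' 0 = t ''family'' 0 + 1"
      "agree {''mark'', ''union'', ''position'', ''quota'', ''family''} t t'"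
      using mark_block_correct[of t "\<Union>(set ` set (take i As))" "As ! i" n] P i n(1)[of "As ! i"]
      by (auto simp: P_def)
    have "P (Suc i) t'"
      using t' P i by (auto simp: P_def take_Suc_conv_app_nth agree_def Un_commute)
    then show "bval (Neg (Less (Var ''level'') (Var ''family''))) t \<and>
        (\<exists>t'. reach (11 * n + 9) (mark_block, t) (Skip, t') \<and> P (Suc i) t')"
      using t'(1) P i level by (auto simp: P_def agree_def)
  qed (use P0 level in \<open>auto simp: P_def agree_def\<close>)
  then obtain s2 where s2: "reach (length As * ((11 * n + 9) + 2) + 1)
      (While (Neg (Less (Var ''level'') (Var ''family''))) mark_block, s1) (Skip, s2)"
      "P (length As) s2"
    by blast
  have "reach (n * (11 * n + 11) + 7) (measure_union, s) (Skip, s2)"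
    unfolding measure_union_def c_def[symmetric]
    by (rule reach_Seq[OF c s2(1)]) (use n(2) in \<open>simp add: mult_le_mono\<close>)
  then show ?thesis using s2(2) by (auto simp: P_def)
qed

lemma descend_correct:
  assumes l: "s ''level'' 0 = l" and todo: "s ''todo'' l = int (length F)"
    and F: "holds (s ''input'') (s ''cursor'' l) (concat (map block F) @ xs)"
    and n: "length F \<le> n"
  shows "\<exists>s' q. reach (5 * n + 11) (descend, s) (Skip, s') \<and>
    agree {''position'', ''quota'', ''level'', ''cursor'', ''todo''} s s' \<and>
    s' ''level'' 0 = l + 1 \<and> holds (s ''input'') q xs \<and>
    s' ''cursor'' = (s ''cursor'')(l + 1 := q + 1) \<and>
    s' ''todo'' = (s ''todo'')(l + 1 := s ''input'' q)"
proof -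
  define c where "c = Seq (Set ''position'' (Load ''cursor'' (Var ''level'')))
    (Set ''quota'' (Load ''todo'' (Var ''level'')))"
  define s1 where "s1 = effect c s"
  have c: "reach 3 (c, s) (Skip, s1)"
    unfolding s1_def by (rule reach_effect) (simp_all add: c_def)
  \<comment> \<open>The invariant tracks the unread input: the blocks not yet skipped, followed by
    \<open>xs\<close>, which in the application encodes the remaining families.\<close>
  define P where "P i t \<longleftrightarrow> holds (s ''input'') (t ''position'' 0) (concat (map block (drop i F)) @ xs) \<and>
    t ''quota'' 0 = int (length F) - int i \<and> agree {''position'', ''quota''} s t"
    for i :: nat and t
  have P0: "P 0 s1"
    using assms by (auto simp: P_def s1_def c_def agree_def fun_eq_iff)
  have "\<exists>s'. reach (length F * (3 + 2) + 1)
      (While (Less (Const 0) (Var ''quota'')) skip_block, s1) (Skip, s') \<and> P (length F) s'"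
  proof (rule reach_counted_loop)
    fix i t assume i: "i < length F" and P: "P i t"
    have d: "drop i F = F ! i # drop (Suc i) F" using i by (rule Cons_nth_drop_Suc[symmetric])
    have "P (Suc i) (effect skip_block t)"
      using P by (auto simp: P_def d skip_block_def agree_def fun_eq_iff block_def algebra_simps)
    moreover have "reach 3 (skip_block, t) (Skip, effect skip_block t)"
      by (rule reach_effect) (simp_all add: skip_block_def)
    ultimately show "bval (Less (Const 0) (Var ''quota'')) t \<and>
        (\<exists>t'. reach 3 (skip_block, t) (Skip, t') \<and> P (Suc i) t')"
      using P i by (auto simp: P_def)
  qed (use P0 in \<open>auto simp: P_def\<close>)
  then obtain s2 where s2: "reach (length F * 5 + 1)
      (While (Less (Const 0) (Var ''quota'')) skip_block, s1) (Skip, s2)" "P (length F) s2"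
    by auto
  define d where "d = Seq (Incr ''level'')
     (Seq (Assign ''cursor'' (Var ''level'') (Plus (Var ''position'') (Const 1)))
          (Assign ''todo'' (Var ''level'') (Load ''input'' (Var ''position''))))"
  have d: "reach 5 (d, s2) (Skip, effect d s2)"
    by (rule reach_effect) (simp_all add: d_def)
  have "reach (5 * n + 11) (descend, s) (Skip, effect d s2)"
    unfolding descend_def c_def[symmetric] d_def[symmetric] using n
    by (intro reach_Seq[OF c] reach_Seq[OF s2(1) d] order.refl) auto
  then show ?thesis
    using s2(2) l
    by (intro exI[of _ "effect d s2"] exI[of _ "s2 ''position'' 0"])
      (auto simp: P_def d_def agree_def fun_eq_iff)
qed

section \<open>Invariants and correctness of the search loop\<close>

definition stacked :: "state \<Rightarrow> int list list \<Rightarrow> bool" where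
  "stacked s As \<longleftrightarrow> unmarked s \<and> s ''output'' 0 = 0 \<and> s ''level'' 0 = int (length As) \<and>
     (\<forall>j<length As. holds (s ''input'') (s ''selected'' (int j)) (block (As ! j)))"

text \<open>\<open>F\<close> is the untried rest of the family at level \<open>l\<close>, and the
  families in \<open>Fs\<close> are still complete. The two lie next to each other in the input,
  which is what lets \<open>descend\<close> find the next family.\<close>

fun pending :: "state \<Rightarrow> int \<Rightarrow> int list list list \<Rightarrow> bool" where
  "pending s l [] \<longleftrightarrow> True"
| "pending s l (F # Fs) \<longleftrightarrow> s ''todo'' l = int (length F) \<and>
     holds (s ''input'') (s ''cursor'' l) (concat (map block F) @ concat (map family_code Fs))"

text \<open>This is the frame condition for a recursive call: whatever happens in a subtree, the
  shallower levels can be resumed where they stopped.\<close>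

definition same_below :: "int \<Rightarrow> state \<Rightarrow> state \<Rightarrow> bool" where
  "same_below l s s' \<longleftrightarrow> s' ''input'' = s ''input'' \<and>
     (\<forall>j<l. s' ''selected'' j = s ''selected'' j \<and> s' ''cursor'' j = s ''cursor'' j \<and>
       s' ''todo'' j = s ''todo'' j)"

lemma same_below_trans:
  "same_below l s s' \<Longrightarrow> same_below l' s' s'' \<Longrightarrow> l \<le> l' \<Longrightarrow> same_below l s s''"
  by (auto simp: same_below_def)

text \<open>Whether or not \<open>A\<close> fits, level \<open>l\<close> is left ready to continue
  with \<open>F\<close>; if \<open>A\<close> fits, the next level is opened in addition.\<close>

lemma try_next_correct:
  fixes A :: "int list" and As :: "int list list"
  defines "l \<equiv> int (length As)" and "Y \<equiv> \<Union>(set ` set As) \<union> set A"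
  assumes s: "stacked s As" "pending s l ((A # F) # Fs)" and k: "s ''input'' 0 = int k"
    and n: "\<And>B. B \<in> set As \<Longrightarrow> length B \<le> n" "length A \<le> n" "length As < n" "length F \<le> n"
  shows "\<exists>s'. reach (11 * n * n + 16 * n + 26) (try_next, s) (Skip, s') \<and>
    same_below l s s' \<and> pending s' l (F # Fs) \<and>
    (if card Y \<le> k then stacked s' (As @ [A]) \<and> pending s' (l + 1) Fs else stacked s' As)"
proof -
  define s1 where "s1 = effect select s"
  have s1: "reach 5 (select, s) (Skip, s1)"
    unfolding s1_def by (rule reach_effect) (simp_all add: select_def)
  have lev: "s ''level'' 0 = l" using s by (simp add: stacked_def l_def)
  have s1_eq: "s1 ''level'' 0 = l" "s1 ''input'' = s ''input''" "s1 ''output'' = s ''output''"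
    "s1 ''selected'' = (s ''selected'')(l := s ''cursor'' l)"
    "s1 ''cursor'' = (s ''cursor'')(l := s ''cursor'' l + (s ''input'' (s ''cursor'' l) + 1))"
    "s1 ''todo'' = (s ''todo'')(l := s ''todo'' l - 1)" "unmarked s1"
    using s lev by (auto simp: s1_def select_def fun_eq_iff stacked_def unmarked_def)
  have sel: "holds (s1 ''input'') (s1 ''selected'' (int j)) (block ((As @ [A]) ! j))"
    if "j < length (As @ [A])" for j
    using that s by (cases "j = length As") (auto simp: s1_eq stacked_def nth_append l_def)
  have pend: "pending s1 l (F # Fs)"
    using s by (auto simp: s1_eq block_def algebra_simps)
  have len: "length B \<le> n" if "B \<in> set (As @ [A])" for B
    using n that by auto
  have "\<Union>(set ` set (As @ [A])) = Y" by (auto simp: Y_def)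
  then obtain s2 where s2: "reach (n * (11 * n + 11) + 7) (measure_union, s1) (Skip, s2)"
    "marked s2 Y" "agree {''mark'', ''union'', ''position'', ''quota'', ''family'', ''round''} s1 s2"
    using measure_union_correct[of s1 "As @ [A]" n] sel len n s1_eq by (auto simp: l_def)
  have s2_eq: "s2 ''level'' = s1 ''level''" "s2 ''input'' = s ''input''" "s2 ''output'' = s ''output''"
    "s2 ''selected'' = s1 ''selected''" "s2 ''cursor'' = s1 ''cursor''" "s2 ''todo'' = s1 ''todo''"
    "unmarked s2"
    using s2 by (auto simp: agree_def s1_eq marked_def)
  have pend2: "pending s2 l (F # Fs)" using pend by (simp add: s2_eq s1_eq)
  have test: "bval (Less (Var ''input'') (Var ''union'')) s2 \<longleftrightarrow> \<not> card Y \<le> k"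
    using s2(2) k by (auto simp: marked_def s2_eq)
  show ?thesis
  proof (cases "card Y \<le> k")
    case False
    have "reach (11 * n * n + 16 * n + 26) (try_next, s) (Skip, s2)"
      unfolding try_next_def
      by (rule reach_Seq[OF s1 reach_Seq[OF s2(1) reach_Cond[where n = 0] order.refl]])
        (use False test in \<open>auto intro: reach.refl simp: algebra_simps\<close>)
    moreover have "stacked s2 As"
      using s by (auto simp: stacked_def s2_eq s1_eq l_def)
    moreover have "same_below l s s2" by (auto simp: same_below_def s2_eq s1_eq)
    ultimately show ?thesis using False pend2 by auto
  next
    case True
    obtain s3 q where s3: "reach (5 * n + 11) (descend, s2) (Skip, s3)"
      "agree {''position'', ''quota'', ''level'', ''cursor'', ''todo''} s2 s3"
      "s3 ''level'' 0 = l + 1" "holds (s ''input'') q (concat (map family_code Fs))"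
      "s3 ''cursor'' = (s2 ''cursor'')(l + 1 := q + 1)"
      "s3 ''todo'' = (s2 ''todo'')(l + 1 := s2 ''input'' q)"
      using descend_correct[of s2 l F "concat (map family_code Fs)" n] pend2 s1_eq s2_eq n
      by auto
    have s3_eq: "s3 ''input'' = s ''input''" "s3 ''output'' = s ''output''"
      "s3 ''selected'' = s1 ''selected''" "s3 ''mark'' = s2 ''mark''" "s3 ''round'' = s2 ''round''"
      using s3(2) by (auto simp: agree_def s2_eq)
    \<comment> \<open>The bound adds 5 for \<open>select\<close>,
      \<open>n * (11 * n + 11) + 7\<close> for \<open>measure_union\<close>,
      \<open>5 * n + 11\<close> for \<open>descend\<close>, and 3 for two sequencings and a
      branch.\<close>
    have "reach (11 * n * n + 16 * n + 26) (try_next, s) (Skip, s3)"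
      unfolding try_next_def
      by (rule reach_Seq[OF s1 reach_Seq[OF s2(1) reach_Cond[where n = "5 * n + 11"] order.refl]])
        (use True test s3(1) in \<open>auto simp: algebra_simps\<close>)
    moreover have "stacked s3 (As @ [A])"
      using s s2_eq(7) s3(3) sel
      by (auto simp: stacked_def s3_eq s1_eq l_def unmarked_def)
    \<comment> \<open>Below the last family \<open>descend\<close> stores whatever follows in the
      input; \<open>pending\<close> asks nothing of these cells.\<close>
    moreover have "pending s3 (l + 1) Fs"
      using s3 by (cases Fs) (auto simp: s3_eq s2_eq family_code_def)
    moreover have "pending s3 l (F # Fs)"
      using pend2 by (simp add: s3 s3_eq s2_eq)
    moreover have "same_below l s s3" by (auto simp: same_below_def s3 s3_eq s2_eq s1_eq)
    ultimately show ?thesis using True by auto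
  qed
qed

lemma reach_search_step:
  assumes "0 \<le> s ''level'' 0" "s ''output'' 0 = 0" "reach t (search_step, s) (Skip, s')"
    "t + 2 \<le> n"
  shows "reach n (search, s) (search, s')"
  unfolding search_def
  by (rule reach_mono[OF reach_While[OF _ assms(3)] assms(4)]) (use assms(1,2) in simp)

text \<open>This dominates \<open>11 * n * n + 16 * n + 30\<close>: the cost of
  \<open>try_next\<close>, two branches of \<open>search_step\<close>, and two steps for the
  loop.\<close>

definition visit_time :: "nat \<Rightarrow> nat" where
  "visit_time n = 30 * (n + 1) ^ 2"

text \<open>The outer induction is on the remaining families, the inner one on the untried sets of
  the first of them. Each unit of \<open>visits\<close> pays for one round. On failure the state is
  back one level up with the shallower levels intact, so the caller can go on.\<close>

lemma search_correct:
  assumes "stacked s As" "pending s (int (length As)) G"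
    and "s ''input'' 0 = int k" "s ''input'' 1 = int (length As + length G)"
    and "\<And>A. A \<in> set As \<Longrightarrow> length A \<le> n"
    and "\<And>F. F \<in> set G \<Longrightarrow> length F \<le> n \<and> (\<forall>A\<in>set F. length A \<le> n)"
    and "length As + length G \<le> n"
  shows "\<exists>s'. reach (visits k (\<Union>(set ` set As)) G * visit_time n) (search, s) (search, s') \<and>
    (if extendable k (\<Union>(set ` set As)) G then s' ''output'' 0 = 1
     else unmarked s' \<and> s' ''output'' 0 = 0 \<and> s' ''level'' 0 = int (length As) - 1 \<and>
       same_below (int (length As)) s s')"
  using assms
proof (induction G arbitrary: s As)
  case Nil
  define s' where "s' = effect (Set ''output'' (Const 1)) s"
  have "reach 2 (search_step, s) (Skip, s')"
    unfolding search_step_def s'_def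
    using Nil.prems reach_effect[of "Set ''output'' (Const 1)" _ s]
    by (intro reach_Cond[where n = 1]) (auto simp: stacked_def)
  then have "reach (visit_time n) (search, s) (search, s')"
    using Nil.prems by (intro reach_search_step[where t = 2])
      (auto simp: stacked_def visit_time_def power2_eq_square)
  moreover have "s' ''output'' 0 = 1" by (simp add: s'_def)
  ultimately show ?case by (intro exI[of _ s']) simp
next
  case (Cons F Fs)
  \<comment> \<open>The outer hypothesis is stored with state and choices generalized, so that the
    inner induction can use it for each child.\<close>
  have Fs_IH: "\<And>s As. \<lbrakk>stacked s As; pending s (int (length As)) Fs; s ''input'' 0 = int k;
      s ''input'' 1 = int (length As + length Fs); \<And>A. A \<in> set As \<Longrightarrow> length A \<le> n;
      length As + length Fs \<le> n\<rbrakk> \<Longrightarrow> \<exists>s'. reach (visits k (\<Union>(set ` set As)) Fs * visit_time n)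
        (search, s) (search, s') \<and>
      (if extendable k (\<Union>(set ` set As)) Fs then s' ''output'' 0 = 1
       else unmarked s' \<and> s' ''output'' 0 = 0 \<and> s' ''level'' 0 = int (length As) - 1 \<and>
         same_below (int (length As)) s s')"
    by (rule Cons.IH) (use Cons.prems(6) in auto)
  show ?case
    using Cons.prems
  proof (induction F arbitrary: s)
    case Nil
    define s' where "s' = effect (Decr ''level'') s"
    have "reach 3 (search_step, s) (Skip, s')"
      unfolding search_step_def s'_def
      using Nil.prems reach_effect[of "Decr ''level''" _ s]
      by (intro reach_Cond[where n = 2]) (auto intro!: reach_Cond[where n = 1] simp: stacked_def)
    then have "reach (visit_time n) (search, s) (search, s')"
      using Nil.prems by (intro reach_search_step[where t = 3])
        (auto simp: stacked_def visit_time_def power2_eq_square)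
    moreover have "unmarked s'" "s' ''output'' 0 = 0" "s' ''level'' 0 = int (length As) - 1"
      "same_below (int (length As)) s s'"
      using Nil.prems by (auto simp: s'_def stacked_def unmarked_def same_below_def)
    ultimately show ?case by (intro exI[of _ s']) simp
  next
    case (Cons A F)
    define X where "X = \<Union>(set ` set As)"
    define l where "l = int (length As)"
    let ?v = "if card (X \<union> set A) \<le> k then visits k (X \<union> set A) Fs else 0"
    have visits: "visits k X ((A # F) # Fs) = 1 + ?v + visits k X (F # Fs)" by simp
    have ext: "extendable k X ((A # F) # Fs) \<longleftrightarrow>
        card (X \<union> set A) \<le> k \<and> extendable k (X \<union> set A) Fs \<or> extendable k X (F # Fs)"
      by auto
    have prems: "stacked s As" "pending s l ((A # F) # Fs)" "s ''input'' 0 = int k"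
      using Cons.prems by (simp_all add: l_def)
    have lengths: "\<And>B. B \<in> set As \<Longrightarrow> length B \<le> n" "length A \<le> n" "length As < n"
      "length F \<le> n"
      using Cons.prems(5,7) Cons.prems(6)[of "A # F"] by auto
    have bounds: "length G \<le> n \<and> (\<forall>B\<in>set G. length B \<le> n)" if "G \<in> set (F # Fs)" for G
      using that Cons.prems(6)[of G] Cons.prems(6)[of "A # F"] by auto
    obtain s1 where s1: "reach (11 * n * n + 16 * n + 26) (try_next, s) (Skip, s1)"
      "same_below l s s1" "pending s1 l (F # Fs)"
      "if card (X \<union> set A) \<le> k then stacked s1 (As @ [A]) \<and> pending s1 (l + 1) Fs
       else stacked s1 As"
      using try_next_correct[OF prems(1) prems(2)[unfolded l_def] prems(3), of n] lengths
      unfolding X_def l_def by blast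
    have lev: "s ''level'' 0 = l" "s ''output'' 0 = 0" using prems by (auto simp: stacked_def l_def)
    have "reach (11 * n * n + 16 * n + 28) (search_step, s) (Skip, s1)"
      unfolding search_step_def
      by (intro reach_Cond[where n = "11 * n * n + 16 * n + 27"])
        (use s1(1) prems Cons.prems(4) lev in
          \<open>auto intro!: reach_Cond[where n = "11 * n * n + 16 * n + 26"] simp: l_def\<close>)
    then have visit: "reach (visit_time n) (search, s) (search, s1)"
      by (rule reach_search_step[rotated 2])
        (use lev in \<open>auto simp: visit_time_def l_def power2_eq_square algebra_simps\<close>)
    have rest: "\<exists>s'. reach (visits k X (F # Fs) * visit_time n) (search, t) (search, s') \<and>
        (if extendable k X (F # Fs) then s' ''output'' 0 = 1
         else unmarked s' \<and> s' ''output'' 0 = 0 \<and> s' ''level'' 0 = int (length As) - 1 \<and>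
           same_below l t s')"
      if "stacked t As" "pending t l (F # Fs)" "same_below l s t" for t
      unfolding X_def l_def
      by (rule Cons.IH[OF that(1) that(2)[unfolded l_def] _ _ Cons.prems(5) bounds])
        (use that(3) Cons.prems(3,4,7) in \<open>auto simp: same_below_def\<close>)
    have child: "\<exists>s'. reach (visits k (X \<union> set A) Fs * visit_time n) (search, s1) (search, s') \<and>
        (if extendable k (X \<union> set A) Fs then s' ''output'' 0 = 1
         else unmarked s' \<and> s' ''output'' 0 = 0 \<and> s' ''level'' 0 = l \<and> same_below (l + 1) s1 s')"
      if "card (X \<union> set A) \<le> k"
    proof -
      have eqs: "\<Union>(set ` set (As @ [A])) = X \<union> set A" "int (length (As @ [A])) = l + 1"
        by (auto simp: X_def l_def)
      have s1': "stacked s1 (As @ [A])" "pending s1 (int (length (As @ [A]))) Fs"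
        using s1(4) that unfolding eqs by simp_all
      show ?thesis
        using Fs_IH[OF s1'] s1(2) Cons.prems(3,4,7) lengths(1,2) unfolding eqs
        by (fastforce simp: same_below_def)
    qed
    consider (skip) "\<not> card (X \<union> set A) \<le> k"
      | (found) "card (X \<union> set A) \<le> k" "extendable k (X \<union> set A) Fs"
      | (failed) "card (X \<union> set A) \<le> k" "\<not> extendable k (X \<union> set A) Fs"
      by blast
    then have "\<exists>s'. reach (visits k X ((A # F) # Fs) * visit_time n) (search, s) (search, s') \<and>
        (if extendable k X ((A # F) # Fs) then s' ''output'' 0 = 1
         else unmarked s' \<and> s' ''output'' 0 = 0 \<and> s' ''level'' 0 = int (length As) - 1 \<and>
           same_below l s s')"
    proof cases
      case skip
      then obtain s' where s': "reach (visits k X (F # Fs) * visit_time n) (search, s1) (search, s')"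
        "if extendable k X (F # Fs) then s' ''output'' 0 = 1
         else unmarked s' \<and> s' ''output'' 0 = 0 \<and> s' ''level'' 0 = int (length As) - 1 \<and>
           same_below l s1 s'"
        using rest[of s1] s1 by auto
      have "reach (visits k X ((A # F) # Fs) * visit_time n) (search, s) (search, s')"
        using reach_trans[OF visit s'(1)] skip by (simp add: visits)
      then show ?thesis
        using s'(2) skip same_below_trans[OF s1(2), of l s']
        unfolding ext by (intro exI[of _ s']) (auto split: if_splits)
    next
      case found
      then obtain s' where s': "reach (visits k (X \<union> set A) Fs * visit_time n) (search, s1) (search, s')"
        "s' ''output'' 0 = 1"
        using child by auto
      \<comment> \<open>The search stops here, so the share of \<open>visits\<close> belonging to
        \<open>F\<close> remains unspent.\<close>
      have "reach (visits k X ((A # F) # Fs) * visit_time n) (search, s) (search, s')"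
        using reach_trans[OF visit s'(1)] found
        by (auto simp: visits algebra_simps intro: reach_mono)
      then show ?thesis using s'(2) found by auto
    next
      case failed
      then obtain s2 where s2: "reach (visits k (X \<union> set A) Fs * visit_time n) (search, s1) (search, s2)"
        "unmarked s2" "s2 ''output'' 0 = 0" "s2 ''level'' 0 = l" "same_below (l + 1) s1 s2"
        using child by auto
      have below: "same_below l s s2" using same_below_trans[OF s1(2) s2(5)] by simp
      have "stacked s2 As" using prems(1) s2 below by (auto simp: stacked_def l_def same_below_def)
      moreover have "pending s2 l (F # Fs)" using s1(3) s2(5) by (auto simp: same_below_def)
      ultimately obtain s' where s': "reach (visits k X (F # Fs) * visit_time n) (search, s2) (search, s')"
        "if extendable k X (F # Fs) then s' ''output'' 0 = 1
         else unmarked s' \<and> s' ''output'' 0 = 0 \<and> s' ''level'' 0 = int (length As) - 1 \<and>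
           same_below l s2 s'"
        using rest[OF _ _ below] by auto
      have "reach (visits k X ((A # F) # Fs) * visit_time n) (search, s) (search, s')"
        using reach_trans[OF visit reach_trans[OF s2(1) s'(1)]] failed
        by (simp add: visits algebra_simps)
      then show ?thesis
        using s'(2) failed same_below_trans[OF below, of l s']
        unfolding ext by (intro exI[of _ s']) (auto split: if_splits)
    qed
    then show ?case by (simp only: X_def l_def)
  qed
qed

section \<open>Correctness of the whole program\<close>

lemma holds_initial: "holds (initial xs ''input'') 0 xs"
  by (simp add: holds_def initial_def)

lemma solver_negative:
  assumes "k < 0" "inp = k # xs"
  shows "\<exists>s'. reach 1 (solver, initial inp) (Skip, s') \<and> s' ''output'' 0 \<noteq> 1"
proof -
  have "initial inp ''input'' 0 = k" using holds_initial[of inp] assms(2) by simp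
  then have "reach 1 (solver, initial inp) (Skip, initial inp)"
    unfolding solver_def using \<open>k < 0\<close> by (intro reach_Cond[where n = 0]) (auto intro: reach.refl)
  then show ?thesis by (intro exI[of _ "initial inp"]) (simp add: initial_def)
qed

lemma solver_correct:
  assumes inp: "inp = int k # int (length L) # concat (map family_code L) @ ys"
    and F: "\<And>F. F \<in> set L \<Longrightarrow> length F \<le> n \<and> (\<forall>A\<in>set F. length A \<le> n)"
    and L: "length L \<le> n"
  shows "\<exists>s'. reach (visits k {} L * visit_time n + 6) (solver, initial inp) (Skip, s') \<and>
    (s' ''output'' 0 = 1 \<longleftrightarrow> extendable k {} L)"
proof -
  define s where "s = initial inp"
  have h: "s ''input'' 0 = int k" "s ''input'' 1 = int (length L)"
    "holds (s ''input'') 2 (concat (map family_code L))"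
    using holds_initial[of inp] unfolding s_def inp by simp_all
  \<comment> \<open>Cells 0 to 2 hold \<open>k\<close>, the number of families and the size of the
    first family, so its first block starts at cell 3. Without families the value loaded from cell 2
    belongs to the universe and is never inspected.\<close>
  define c where "c = Seq (Set ''cursor'' (Const 3)) (Set ''todo'' (Load ''input'' (Const 2)))"
  define s1 where "s1 = effect c s"
  have c: "reach 3 (c, s) (Skip, s1)"
    unfolding s1_def by (rule reach_effect) (simp_all add: c_def)
  have s1: "s1 ''input'' = s ''input''" "s1 ''cursor'' 0 = 3" "s1 ''todo'' 0 = s ''input'' 2"
    "stacked s1 []"
    by (auto simp: s1_def c_def fun_eq_iff stacked_def unmarked_def s_def initial_def)
  have "pending s1 0 L"
    using h(3) s1 by (cases L) (auto simp: family_code_def)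
  then obtain s2 where s2: "reach (visits k {} L * visit_time n) (search, s1) (search, s2)"
    "if extendable k {} L then s2 ''output'' 0 = 1
     else s2 ''output'' 0 = 0 \<and> s2 ''level'' 0 = -1"
    using search_correct[of s1 "[]" L k n] s1 h F L by (auto split: if_splits)
  have "reach 1 (search, s2) (Skip, s2)"
    unfolding search_def by (rule reach_While_exit) (use s2(2) in \<open>simp split: if_splits\<close>)
  from reach_trans[OF s2(1) this]
  \<comment> \<open>The 6 extra steps are 3 for the initialization and one each for sequencing,
    leaving the loop and the branch on the sign of \<open>k\<close>.\<close>
  have "reach (visits k {} L * visit_time n + 6) (solver, s) (Skip, s2)"
    unfolding solver_def c_def[symmetric]
    by (intro reach_Cond[where n = "visits k {} L * visit_time n + 5"])
      (auto simp: h intro: reach_Seq[OF c])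
  then show ?thesis using s2(2) by (auto simp: s_def split: if_splits)
qed

section \<open>The running time\<close>

text \<open>Rounding the logarithm up costs at most 1, which is at most
  \<open>log 2 (real D)\<close> once \<open>D \<ge> 2\<close>. For \<open>D = 1\<close> the
  logarithm vanishes and the exponent has to be 0.\<close>

lemma ex_power_of_2_between:
  assumes "D \<ge> 1"
  shows "\<exists>e. D \<le> 2 ^ e \<and> 2 ^ e \<le> 2 * D \<and> real e \<le> 2 * log 2 (real D)"
proof (cases "D = 1")
  case True
  then show ?thesis by (intro exI[of _ 0]) simp
next
  case False
  then have D: "real D \<ge> 2" using assms by linarith
  then have log: "log 2 (real D) \<ge> 1" by (simp add: le_log_iff)
  define e where "e = nat \<lceil>log 2 (real D)\<rceil>"
  have e: "log 2 (real D) \<le> real e" "real e \<le> log 2 (real D) + 1"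
    using log unfolding e_def by linarith+
  have "real D = 2 powr log 2 (real D)" using D by simp
  also have "\<dots> \<le> 2 powr real e" using e by simp
  finally have "real D \<le> real (2 ^ e)" by (simp add: powr_realpow)
  moreover have "real (2 ^ e) = 2 powr real e" by (simp add: powr_realpow)
  then have "real (2 ^ e) \<le> 2 powr (log 2 (real D) + 1)" using e by simp
  then have "real (2 ^ e) \<le> real (2 * D)" using D by (simp add: powr_add)
  ultimately have "D \<le> 2 ^ e \<and> 2 ^ e \<le> 2 * D" unfolding of_nat_le_iff by simp
  moreover have "real e \<le> 2 * log 2 (real D)" using e log by linarith
  ultimately show ?thesis by blast
qed

lemma running_time_le:
  fixes N m d k :: nat and L :: "int list list list"
  defines "S \<equiv> N + m + 1"
  assumes "length L = m"
    and F: "\<And>F. F \<in> set L \<Longrightarrow> listed_wide k F \<and> length F \<le> N + 1 \<and> length F \<le> d"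
  shows "real (visits k {} L * visit_time S + 6)
    \<le> 500 * max 1 (real k) powr (2 * log 2 (real (max 1 d))) * real S ^ 5"
proof -
  \<comment> \<open>The cap \<open>d\<close> keeps \<open>e\<close> logarithmic in \<open>d\<close>,
    and the cap \<open>N + 1\<close> makes \<open>2 ^ e \<le> 2 * D\<close> linear in
    \<open>S\<close>. Both bound the family sizes.\<close>
  define D where "D = max 1 (min d (N + 1))"
  obtain e where e: "D \<le> 2 ^ e" "2 ^ e \<le> 2 * D" "real e \<le> 2 * log 2 (real D)"
    using ex_power_of_2_between[of D] by (auto simp: D_def)
  define M where "M = max 1 (real k)"
  define W where "W = M powr (2 * log 2 (real (max 1 d)))"
  have S: "real D \<le> real S" "real m + 1 \<le> real S" "1 \<le> real S"
    by (simp_all add: D_def S_def)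
  have M: "M \<ge> 1" by (simp add: M_def)
  have "real e \<le> 2 * log 2 (real (max 1 d))"
    using e(3) by (rule order.trans) (simp add: D_def)
  then have We: "M ^ e \<le> W"
    using M by (simp add: W_def powr_mono flip: powr_realpow)
  have "real (2 ^ e) \<le> real (2 * D)" using e(2) by (simp only: of_nat_le_iff)
  then have eS: "real (2 ^ e) \<le> 2 * real S" using S by simp
  have W: "1 \<le> W" using We one_le_power[OF M, of e] by linarith
  have "visits k {} L \<le> (D + 1) * (m + 1) * (k + 1) ^ e"
    using visits_le[of L k D e "{}"] F assms(2) e(1) by (force simp: D_def)
  then have "real (visits k {} L) \<le> real ((D + 1) * (m + 1) * (k + 1) ^ e)"
    by (simp only: of_nat_le_iff)
  also have "\<dots> = (real D + 1) * (real m + 1) * (real k + 1) ^ e"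
    by (simp only: of_nat_mult of_nat_add of_nat_power of_nat_1)
  also have "\<dots> \<le> (2 * real S) * real S * (2 * real S * W)"
  proof (intro mult_mono)
    \<comment> \<open>Passing from \<open>k + 1\<close> to \<open>M\<close> costs a factor of at
      most 2 per power, and \<open>2 ^ e\<close> is absorbed by \<open>2 * real S\<close>.\<close>
    have "(real k + 1) ^ e \<le> (2 * M) ^ e"
      by (intro power_mono) (auto simp: M_def)
    also have "\<dots> = real (2 ^ e) * M ^ e" by (simp add: power_mult_distrib)
    also have "\<dots> \<le> (2 * real S) * W"
      using eS We M by (intro mult_mono) auto
    finally show "(real k + 1) ^ e \<le> 2 * real S * W" .
  qed (use S in auto)
  finally have v: "real (visits k {} L) \<le> 4 * real S ^ 3 * W"
    by (simp add: power3_eq_cube mult_ac)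
  have t: "real (visit_time S) \<le> 30 * (2 * real S) ^ 2"
    using S power_mono[of "real S + 1" "2 * real S" 2] by (simp add: visit_time_def add.commute)
  have "real (visits k {} L * visit_time S + 6)
      = real (visits k {} L) * real (visit_time S) + 6" by simp
  also have "\<dots> \<le> (4 * real S ^ 3 * W) * (30 * (2 * real S) ^ 2) + 6 * (W * real S ^ 5)"
    using v t W S mult_mono[of 1 W 1 "real S ^ 5"] by (intro add_mono mult_mono) auto
  \<comment> \<open>The product gives 4 * 30 * 4 = 480, and the additive 6 is absorbed because both
    \<open>W\<close> and \<open>S\<close> are at least 1.\<close>
  also have "\<dots> = 486 * (W * real S ^ 5)"
    by (simp add: power2_eq_square eval_nat_numeral)
  also have "\<dots> \<le> 500 * (W * real S ^ 5)" using W by (intro mult_right_mono) auto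
  finally show ?thesis by (simp add: W_def M_def mult.assoc)
qed

text \<open>Every member except possibly the empty set contributes at least 1 to the sum.\<close>

lemma card_family_le:
  assumes "finite F" "\<And>A. A \<in> F \<Longrightarrow> finite A"
  shows "card F \<le> (\<Sum>A\<in>F. card A) + 1"
proof -
  have "card F \<le> card (F - {{}}) + 1"
    using assms(1) by (cases "{} \<in> F") (auto simp: card_Diff_singleton)
  also have "card (F - {{}}) \<le> (\<Sum>A\<in>F - {{}}. card A)"
    using sum_mono[of "F - {{}}" "\<lambda>A. 1" card] assms(2) by (auto simp: Suc_le_eq card_gt_0_iff)
  also have "\<dots> \<le> (\<Sum>A\<in>F. card A)" using assms(1) by (intro sum_mono2) auto
  finally show ?thesis by simp
qed

text \<open>A deterministic run ends in a point distribution, so a correct answer has probability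
  1.\<close>

lemma decides_withinI:
  assumes "reach n (p, initial xs) (Skip, s)" "s ''output'' 0 = 1 \<longleftrightarrow> answer" "real n \<le> T"
  shows "decides_within p xs answer T"
proof -
  obtain t where "t \<le> n" "run t (p, initial xs) = return_pmf (Skip, s)"
    using reach_run[OF assms(1)] by blast
  then show ?thesis
    unfolding decides_within_def using assms(2,3) by (intro exI[of _ t]) auto
qed

lemma solver_decides:
  assumes inst: "wfh_instance k U Fs" and d: "\<forall>F\<in>set Fs. card F \<le> d"
    and code: "wfh_code inp k U Fs"
  shows "decides_within solver inp (wfh_yes k Fs)
    (500 * real_of_int (max 1 k) powr (2 * log 2 (real (max 1 d)))
      * real (wfh_size Fs + length Fs + 1) ^ 5)"
proof -
  obtain us L where L: "list_all2 lists_family L Fs"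
    "inp = k # int (length L) # concat (map family_code L) @ block us"
    using code by (auto simp: wfh_code_def)
  have len: "length L = length Fs" using L(1) by (rule list_all2_lengthD)
  have nth: "lists_family (L ! i) (Fs ! i)" if "i < length L" for i
    using L(1) that by (rule list_all2_nthD)
  have Fs: "Fs ! i = set ` set (L ! i)" if "i < length L" for i
    using nth[OF that] by (simp add: lists_family_def)
  define N where "N = wfh_size Fs"
  have F: "distinct (map set F)" "wide k (set ` set F)" "length F \<le> N + 1" "length F \<le> d"
    "\<forall>A\<in>set F. length A \<le> N" if "F \<in> set L" for F
  proof -
    obtain i where i: "i < length L" "F = L ! i" using \<open>F \<in> set L\<close> by (metis in_set_conv_nth)
    define G where "G = set ` set F"
    have mem: "G \<in> set Fs" using Fs i len unfolding G_def by (metis nth_mem)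
    have fam: "lists_family F G" using nth[OF i(1)] Fs i by (simp add: G_def)
    then show dist: "distinct (map set F)" by (simp add: lists_family_def)
    have card: "card G = length F"
      using distinct_card[OF dist] by (simp add: G_def)
    have size: "(\<Sum>A\<in>G. card A) \<le> N"
      unfolding N_def wfh_size_def using mem by (intro member_le_sum_list) auto
    show "wide k (set ` set F)" using inst mem by (auto simp: wfh_instance_def G_def)
    show "length F \<le> d" using d mem card by auto
    show "length F \<le> N + 1"
      using card_family_le[of G] card size by (force simp: G_def)
    show "\<forall>A\<in>set F. length A \<le> N"
    proof
      fix A assume A: "A \<in> set F"
      have "length A = card (set A)"
        using fam A by (simp add: lists_family_def distinct_card)
      also have "\<dots> \<le> (\<Sum>A\<in>G. card A)"
        using A by (intro member_le_sum) (auto simp: G_def)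
      finally show "length A \<le> N" using size by simp
    qed
  qed
  show ?thesis
  proof (cases "k < 0")
    case True
    have "\<not> wfh_yes k Fs" using True by (auto simp: wfh_yes_def)
    moreover obtain s where "reach 1 (solver, initial inp) (Skip, s)" "s ''output'' 0 \<noteq> 1"
      using solver_negative[OF True L(2)] by blast
    \<comment> \<open>For negative \<open>k\<close> the base \<open>max 1 k\<close> is 1, so the
      power is 1 and the bound leaves room for the single step taken.\<close>
    moreover have "1 \<le> 500 * real_of_int (max 1 k) powr x * w" if "1 \<le> w" for x w
      using True that by simp
    ultimately show ?thesis by (intro decides_withinI[where n = 1]) (auto intro: one_le_power)
  next
    case False
    \<comment> \<open>This one number bounds the sizes of the sets (at most \<open>N\<close>), the
      sizes of the families (at most \<open>N + 1\<close>) and the number of families.\<close>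
    define n where "n = N + length L + 1"
    have k: "k = int (nat k)" using False by simp
    have le: "int c \<le> k \<longleftrightarrow> c \<le> nat k" for c using False by linarith
    have "wfh_yes k Fs \<longleftrightarrow> (\<exists>S. (\<forall>i<length L. S i \<in> set ` set (L ! i)) \<and>
        card ({} \<union> (\<Union>i<length L. S i)) \<le> nat k)"
      unfolding wfh_yes_def by (simp add: len[symmetric] Fs le)
    then have yes: "wfh_yes k Fs \<longleftrightarrow> extendable (nat k) {} L"
      by (simp add: extendable_iff)
    obtain s where s: "reach (visits (nat k) {} L * visit_time n + 6) (solver, initial inp) (Skip, s)"
      "s ''output'' 0 = 1 \<longleftrightarrow> extendable (nat k) {} L"
      using solver_correct[of inp "nat k" L "block us" n] L(2) k F
      by (force simp: n_def)
    have "real (visits (nat k) {} L * visit_time n + 6)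
        \<le> 500 * max 1 (real (nat k)) powr (2 * log 2 (real (max 1 d))) * real n ^ 5"
      unfolding n_def using F k by (intro running_time_le) (auto simp: listed_wide_def)
    also have "max 1 (real (nat k)) = real_of_int (max 1 k)" using False by simp
    finally show ?thesis
      using s yes by (intro decides_withinI) (auto simp: n_def N_def len)
  qed
qed

theorem theorem8:
  "\<exists>(p :: com) (a :: real) (b :: real) (c :: nat).
     \<forall>(d :: nat) (k :: int) (U :: int set) (Fs :: int set set list) (inp :: int list).
       wfh_instance k U Fs \<longrightarrow> (\<forall>F\<in>set Fs. card F \<le> d) \<longrightarrow> wfh_code inp k U Fs \<longrightarrow>
       decides_within p inp (wfh_yes k Fs)
         (a * real_of_int (max 1 k) powr (b * log 2 (real (max 1 d)))
            * real (wfh_size Fs + length Fs + 1) ^ c)"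
  \<comment> \<open>The witnesses are \<open>solver\<close>, 500, 2 and 5.\<close>
  using solver_decides by blast

end
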